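(* Let $(E,\mathcal{F})$ be an accessible set system over a finite set $E$ of rank $k$ such that $\Gamma(X)\neq\emptyset$ for every $X\in\mathcal{F}_{k-1}=\{X\in\mathcal{F}:|X|\le k-1\}$. Then the following are equivalent: (i) $(E,\mathcal{F})$ is a $k$-truncated antimatroid; (ii) for every monotone linkage function $\pi:E\times 2^E\to\mathbb{R}$, the set function $F:\mathcal{F}_{k-1}\to\mathbb{R}$ given by $F(X)=\min_{x\in\Gamma(X)}\pi(x,X)$ is quasi-concave.
   Context: A set system over $E$ is a pair $(E,\mathcal{F})$ with $\mathcal{F}\subseteq 2^E$; members of $\mathcal{F}$ are feasible; its rank is the maximum cardinality of a feasible set. It is accessible if every non-empty $X\in\mathcal{F}$ contains some $x$ with $X-\{x\}\in\mathcal{F}$. A non-empty set system $(E,\mathcal{A})$ is an antimatroid if it is accessible and for all $X,Y\in\mathcal{A}$ with $X\not\subseteq Y$ there is $x\in X-Y$ with $Y\cup\{x\}\in\mathcal{A}$. A $k$-truncated antimatroid is a set system $(E,\mathcal{F})$ with $\mathcal{F}=\{X\in\mathcal{A}:|X|\le k\}$ for some antimatroid $(E,\mathcal{A})$. For $X\in\mathcal{F}$, $\Gamma(X)=\{x\in E-X: X\cup\{x\}\in\mathcal{F}\}$. A function $\pi:E\times 2^{E}\to\mathbb{R}$ is a monotone linkage function if for all $X\subseteq Y\subseteq E$ and $x\in E$, $\pi(x,X)\ge\pi(x,Y)$. A set function $F$ on $\mathcal{F}_{k-1}$ is quasi-concave if for all $X,Y\in\mathcal{F}_{k-1}$ and every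 maximal feasible subset $Z$ of $X\cap Y$ (maximal member of $\mathcal{F}$ contained in $X\cap Y$), $F(Z)\ge\min\{F(X),F(Y)\}$. *)

theory Defs
  imports Complex_Main
begin

definition set_system :: "'a set \<Rightarrow> 'a set set \<Rightarrow> bool" where
  "set_system E \<F> \<longleftrightarrow> \<F> \<subseteq> Pow E"

text \<open>A rank exists only for a non-empty family, and \<^const>\<open>Max\<close> is
  unspecified on the empty set, so non-emptiness is part of having a rank.\<close>

definition has_rank :: "'a set set \<Rightarrow> nat \<Rightarrow> bool" where
  "has_rank \<F> k \<longleftrightarrow> \<F> \<noteq> {} \<and> k = Max (card ` \<F>)"

definition accessible :: "'a set set \<Rightarrow> bool" where
  "accessible \<F> \<longleftrightarrow> (\<forall>X\<in>\<F>. X \<noteq> {} \<longrightarrow> (\<exists>x\<in>X. X - {x} \<in> \<F>))"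

definition antimatroid :: "'a set \<Rightarrow> 'a set set \<Rightarrow> bool" where
  "antimatroid E \<A> \<longleftrightarrow> set_system E \<A> \<and> \<A> \<noteq> {} \<and> accessible \<A> \<and>
     (\<forall>X\<in>\<A>. \<forall>Y\<in>\<A>. \<not> X \<subseteq> Y \<longrightarrow> (\<exists>x\<in>X - Y. Y \<union> {x} \<in> \<A>))"

definition truncated_antimatroid :: "nat \<Rightarrow> 'a set \<Rightarrow> 'a set set \<Rightarrow> bool" where
  "truncated_antimatroid k E \<F> \<longleftrightarrow>
     (\<exists>\<A>. antimatroid E \<A> \<and> \<F> = {X \<in> \<A>. card X \<le> k})"

text \<open>The bound is an integer so that the level \<open>k - 1\<close> is empty for \<open>k = 0\<close>.\<close>

definition feasible_upto :: "'a set set \<Rightarrow> int \<Rightarrow> 'a set set" where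
  "feasible_upto \<F> m = {X \<in> \<F>. int (card X) \<le> m}"

definition Gam :: "'a set \<Rightarrow> 'a set set \<Rightarrow> 'a set \<Rightarrow> 'a set" where
  "Gam E \<F> X = {x \<in> E - X. X \<union> {x} \<in> \<F>}"

definition monotone_linkage :: "'a set \<Rightarrow> ('a \<Rightarrow> 'a set \<Rightarrow> real) \<Rightarrow> bool" where
  "monotone_linkage E \<pi> \<longleftrightarrow>
     (\<forall>X Y. X \<subseteq> Y \<and> Y \<subseteq> E \<longrightarrow> (\<forall>x\<in>E. \<pi> x X \<ge> \<pi> x Y))"

definition linkage_min :: "'a set \<Rightarrow> 'a set set \<Rightarrow> ('a \<Rightarrow> 'a set \<Rightarrow> real) \<Rightarrow> 'a set \<Rightarrow> real" where
  "linkage_min E \<F> \<pi> X = Min ((\<lambda>x. \<pi> x X) ` Gam E \<F> X)"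

definition maximal_feasible_subset :: "'a set set \<Rightarrow> 'a set \<Rightarrow> 'a set \<Rightarrow> bool" where
  "maximal_feasible_subset \<F> S Z \<longleftrightarrow>
     Z \<in> \<F> \<and> Z \<subseteq> S \<and> (\<forall>W\<in>\<F>. W \<subseteq> S \<and> Z \<subseteq> W \<longrightarrow> W = Z)"

definition quasi_concave :: "'a set set \<Rightarrow> nat \<Rightarrow> ('a set \<Rightarrow> real) \<Rightarrow> bool" where
  "quasi_concave \<F> k F \<longleftrightarrow>
     (\<forall>X\<in>feasible_upto \<F> (int k - 1). \<forall>Y\<in>feasible_upto \<F> (int k - 1).
        \<forall>Z. maximal_feasible_subset \<F> (X \<inter> Y) Z \<longrightarrow> F Z \<ge> min (F X) (F Y))"

end

theory Submission imports Defs begin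

text \<open>
  Both conditions are equivalent to the following extension property: if \<open>A \<subseteq> B\<close> are feasible,
  \<open>|B| < k\<close>, \<open>x \<notin> B\<close> and \<open>A \<union> {x}\<close> is feasible, then so is \<open>B \<union> {x}\<close>.
  If it fails for \<open>A, B, x\<close>, the linkage function that is \<open>0\<close> at \<open>x\<close> and \<open>1\<close> elsewhere violates
  quasi-concavity at the pair \<open>B\<close>, \<open>A \<union> {x}\<close>, whose intersection is \<open>A\<close>.
  Conversely, given the extension property, the unions of feasible sets form an antimatroid
  whose \<open>k\<close>-truncation is the given family.
\<close>

section \<open>The extension property and chains in accessible set systems\<close>

definition extendable :: "'a set set \<Rightarrow> nat \<Rightarrow> bool" where
  "extendable \<F> k \<longleftrightarrow> (\<forall>A\<in>\<F>. \<forall>B\<in>\<F>. \<forall>x. A \<subseteq> B \<and> card B < k \<and> x \<notin> B \<and> insert x A \<in> \<F>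
     \<longrightarrow> insert x B \<in> \<F>)"

text \<open>By accessibility \<open>X\<close> can be stripped one element at a time within
  \<open>\<F>\<close>. The first set on this way down that lies in \<open>W\<close> is
  \<open>A\<close>, and \<open>x\<close> is the element removed to reach it.\<close>

lemma accessible_first_exit:
  assumes "accessible \<F>" "finite X" "X \<in> \<F>" "\<not> X \<subseteq> W"
  obtains A x where "A \<in> \<F>" "A \<subseteq> W" "A \<subseteq> X" "x \<in> X - W" "insert x A \<in> \<F>"
proof -
  have "\<exists>A x. A \<in> \<F> \<and> A \<subseteq> W \<and> A \<subseteq> X \<and> x \<in> X - W \<and> insert x A \<in> \<F>"
    using assms(2-4)
  proof (induction X rule: finite_psubset_induct)
    case (psubset X)
    then obtain y where y: "y \<in> X" "X - {y} \<in> \<F>"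
      using assms(1) unfolding accessible_def by blast
    show ?case
    proof (cases "X - {y} \<subseteq> W")
      case True
      with psubset.prems y have "y \<in> X - W" "insert y (X - {y}) \<in> \<F>"
        by (auto simp: insert_absorb)
      with True y show ?thesis by blast
    next
      case False
      moreover have "X - {y} \<subset> X" using y by blast
      ultimately show ?thesis using psubset.IH[of "X - {y}"] y by blast
    qed
  qed
  with that show thesis by blast
qed

lemma accessible_empty_mem:
  assumes "accessible \<F>" "finite X" "X \<in> \<F>"
  shows "{} \<in> \<F>"
proof (cases "X = {}")
  case False
  \<comment> \<open>Taking \<open>W = {}\<close> forces the set \<open>A\<close> of the first exit
    to be empty.\<close>
  then have "\<not> X \<subseteq> {}" by blast
  with assms show ?thesis by (metis accessible_first_exit subset_empty)
qed (use assms in simp)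

lemma finite_maximal_mem:
  assumes "finite U" "Y \<in> \<A>" "Y \<subseteq> U"
  obtains M where "M \<in> \<A>" "M \<subseteq> U" "\<And>N. N \<in> \<A> \<Longrightarrow> N \<subseteq> U \<Longrightarrow> M \<subseteq> N \<Longrightarrow> N = M"
proof -
  have "finite {N \<in> \<A>. N \<subseteq> U}"
    by (rule finite_subset[of _ "Pow U"]) (use assms in auto)
  moreover have "{N \<in> \<A>. N \<subseteq> U} \<noteq> {}" using assms by auto
  ultimately have "\<exists>M\<in>{N \<in> \<A>. N \<subseteq> U}. \<forall>N\<in>{N \<in> \<A>. N \<subseteq> U}. M \<subseteq> N \<longrightarrow> M = N"
    by (rule finite_has_maximal)
  then obtain M where "M \<in> \<A>" "M \<subseteq> U" "\<forall>N\<in>{N \<in> \<A>. N \<subseteq> U}. M \<subseteq> N \<longrightarrow> M = N"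
    by auto
  then show thesis by (intro that) auto
qed

section \<open>The antimatroid generated by an accessible set system\<close>

definition union_closure :: "'a set set \<Rightarrow> 'a set set" where
  "union_closure \<F> = {\<Union>\<G> |\<G>. \<G> \<subseteq> \<F>}"

lemma union_closure_superset: "\<F> \<subseteq> union_closure \<F>"
proof
  fix X assume "X \<in> \<F>"
  then have "X = \<Union>{X}" "{X} \<subseteq> \<F>" by auto
  then show "X \<in> union_closure \<F>" unfolding union_closure_def by blast
qed

lemma union_closure_Un:
  assumes "U \<in> union_closure \<F>" "V \<in> union_closure \<F>"
  shows "U \<union> V \<in> union_closure \<F>"
proof -
  obtain \<G> \<H> where "\<G> \<subseteq> \<F>" "\<H> \<subseteq> \<F>" "U = \<Union>\<G>" "V = \<Union>\<H>"
    using assms unfolding union_closure_def by blast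
  then have "U \<union> V = \<Union>(\<G> \<union> \<H>)" "\<G> \<union> \<H> \<subseteq> \<F>" by auto
  then show ?thesis unfolding union_closure_def by blast
qed

lemma union_closure_not_subset:
  assumes "U \<in> union_closure \<F>" "\<not> U \<subseteq> W"
  obtains X where "X \<in> \<F>" "X \<subseteq> U" "\<not> X \<subseteq> W"
  using assms unfolding union_closure_def by blast

text \<open>Some \<open>X\<close> in \<open>\<F>\<close> lies inside \<open>U\<close> but not inside
  \<open>W\<close>. Its chain leaves \<open>W\<close> with a step from \<open>A\<close> to
  \<open>insert x A\<close>, and joining the latter to \<open>W\<close> adds \<open>x\<close>
  alone.\<close>

lemma union_closure_augment:
  assumes "accessible \<F>" "finite U" "U \<in> union_closure \<F>" "W \<in> union_closure \<F>" "\<not> U \<subseteq> W"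
  obtains x where "x \<in> U - W" "insert x W \<in> union_closure \<F>"
proof -
  obtain X where X: "X \<in> \<F>" "X \<subseteq> U" "\<not> X \<subseteq> W"
    using assms union_closure_not_subset by blast
  then have "finite X" using assms finite_subset by blast
  then obtain A x where A: "A \<subseteq> W" "x \<in> X - W" "insert x A \<in> \<F>"
    by (rule accessible_first_exit[OF assms(1) _ X(1,3)])
  have "W \<union> insert x A \<in> union_closure \<F>"
    using union_closure_Un assms(4) A(3) union_closure_superset by blast
  moreover have "W \<union> insert x A = insert x W" using A by blast
  ultimately show thesis using that A X by auto
qed

text \<open>Exchange is \<open>union_closure_augment\<close>. Accessibility follows from it too: a
  maximal member strictly below \<open>U\<close> can be augmented by one element of
  \<open>U\<close>, and maximality forces the result to be \<open>U\<close>.\<close>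

lemma antimatroid_union_closure:
  assumes "finite E" "set_system E \<F>" "accessible \<F>"
  shows "antimatroid E (union_closure \<F>)"
  unfolding antimatroid_def
proof (intro conjI ballI impI)
  show sys: "set_system E (union_closure \<F>)"
    using assms(2) unfolding set_system_def union_closure_def by blast
  then have fin: "finite U" if "U \<in> union_closure \<F>" for U
    using assms(1) that finite_subset unfolding set_system_def by blast
  have empty: "{} \<in> union_closure \<F>" unfolding union_closure_def by blast
  then show "union_closure \<F> \<noteq> {}" by blast
  show "\<exists>x\<in>X - Y. Y \<union> {x} \<in> union_closure \<F>"
    if "X \<in> union_closure \<F>" "Y \<in> union_closure \<F>" "\<not> X \<subseteq> Y" for X Y
    using union_closure_augment[OF assms(3) fin that] that by auto
  show "accessible (union_closure \<F>)"
    unfolding accessible_def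
  proof (intro ballI impI)
    fix U assume U: "U \<in> union_closure \<F>" "U \<noteq> {}"
    obtain W where W: "W \<in> union_closure \<F> - {U}" "W \<subseteq> U"
      and max: "\<And>N. N \<in> union_closure \<F> - {U} \<Longrightarrow> N \<subseteq> U \<Longrightarrow> W \<subseteq> N \<Longrightarrow> N = W"
      using finite_maximal_mem[OF fin[OF U(1)], of "{}" "union_closure \<F> - {U}"] U empty by blast
    then have "\<not> U \<subseteq> W" by blast
    then obtain x where x: "x \<in> U - W" "insert x W \<in> union_closure \<F>"
      using union_closure_augment[OF assms(3) fin[OF U(1)] U(1), of W] W by blast
    then have "insert x W = U"
      using max[of "insert x W"] W by blast
    then have "U - {x} = W" using x by blast
    then show "\<exists>x\<in>U. U - {x} \<in> union_closure \<F>" using x W by blast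
  qed
qed

text \<open>The union closure is the natural candidate, since any antimatroid containing
  \<open>\<F>\<close> is closed under unions. What has to be shown is that unions of size at most
  \<open>k\<close> are already feasible.\<close>

lemma extendable_imp_truncated_antimatroid:
  assumes "finite E" "set_system E \<F>" "accessible \<F>" "\<F> \<noteq> {}"
    and rank: "\<And>X. X \<in> \<F> \<Longrightarrow> card X \<le> k"
    and ext: "extendable \<F> k"
  shows "truncated_antimatroid k E \<F>"
proof -
  have fin: "finite X" if "X \<in> \<F>" for X
    using assms(1,2) that finite_subset unfolding set_system_def by blast
  have "U \<in> \<F>" if U: "U \<in> union_closure \<F>" "card U \<le> k" for U
  proof -
    have "U \<subseteq> E"
      using U(1) assms(2) unfolding union_closure_def set_system_def by blast
    then have finU: "finite U" using assms(1) finite_subset by blast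
    have "{} \<in> \<F>" using accessible_empty_mem assms(3,4) fin by blast
    \<comment> \<open>If this maximal feasible subset of \<open>U\<close> were not all of
      \<open>U\<close>, a chain leaving it would let the extension property enlarge it within
      \<open>U\<close>.\<close>
    then obtain Y where Y: "Y \<in> \<F>" "Y \<subseteq> U"
      and max: "\<And>N. N \<in> \<F> \<Longrightarrow> N \<subseteq> U \<Longrightarrow> Y \<subseteq> N \<Longrightarrow> N = Y"
      using finite_maximal_mem[OF finU, of "{}"] by blast
    have "U \<subseteq> Y"
    proof (rule ccontr)
      assume n: "\<not> U \<subseteq> Y"
      then obtain X where X: "X \<in> \<F>" "X \<subseteq> U" "\<not> X \<subseteq> Y"
        using U union_closure_not_subset by blast
      then obtain A x where A: "A \<in> \<F>" "A \<subseteq> Y" "x \<in> X - Y" "insert x A \<in> \<F>"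
        using accessible_first_exit[OF assms(3) fin[OF X(1)] X(1,3)] by metis
      \<comment> \<open>Properness yields the strict bound below \<open>k\<close> that
        \<open>extendable\<close> asks for.\<close>
      have "card Y < card U" using n Y finU by (intro psubset_card_mono) auto
      then have "insert x Y \<in> \<F>"
        using ext A Y U(2) unfolding extendable_def by (meson DiffD2 less_le_trans)
      then show False using max[of "insert x Y"] Y A X by blast
    qed
    with Y show ?thesis by auto
  qed
  then have "\<F> = {X \<in> union_closure \<F>. card X \<le> k}"
    using union_closure_superset rank by blast
  then show ?thesis
    using antimatroid_union_closure[OF assms(1-3)] unfolding truncated_antimatroid_def by blast
qed

section \<open>From truncated antimatroids to quasi-concavity\<close>

lemma truncated_antimatroid_augment:
  assumes "truncated_antimatroid k E \<F>" "Z \<in> \<F>" "X \<in> \<F>" "Z \<subseteq> X" "card X < k"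
    and "x \<in> Gam E \<F> Z" "x \<notin> X"
  shows "x \<in> Gam E \<F> X"
proof -
  obtain \<A> where \<A>: "antimatroid E \<A>" "\<F> = {X \<in> \<A>. card X \<le> k}"
    using assms(1) unfolding truncated_antimatroid_def by blast
  have "X \<in> \<A>" "Z \<union> {x} \<in> \<A>" "\<not> Z \<union> {x} \<subseteq> X" and xE: "x \<in> E"
    using assms \<A> unfolding Gam_def by auto
  \<comment> \<open>Exchange \<open>Z \<union> {x}\<close> against \<open>X\<close>: as
    \<open>Z \<subseteq> X\<close>, the added element can only be \<open>x\<close>, and
    \<open>card X < k\<close> keeps the result in the truncation.\<close>
  then obtain y where y: "y \<in> Z \<union> {x} - X" "X \<union> {y} \<in> \<A>"
    using \<A>(1) unfolding antimatroid_def by metis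
  with assms(4) have "y = x" by blast
  moreover have "card (X \<union> {x}) \<le> k" using assms(5) card_insert_le_m1[of k X x] by simp
  ultimately show ?thesis using y \<A>(2) assms(7) xE unfolding Gam_def by simp
qed

text \<open>Let \<open>x\<close> attain the minimum at \<open>Z\<close>. It misses \<open>X\<close>
  or \<open>Y\<close>, and it can still be added to the one it misses, where monotonicity makes its
  linkage value no larger.\<close>

lemma truncated_antimatroid_imp_quasi_concave:
  assumes fE: "finite E" and sys: "set_system E \<F>"
    and Gam: "\<forall>X\<in>feasible_upto \<F> (int k - 1). Gam E \<F> X \<noteq> {}"
    and tr: "truncated_antimatroid k E \<F>" and mono: "monotone_linkage E \<pi>"
  shows "quasi_concave \<F> k (linkage_min E \<F> \<pi>)"
  unfolding quasi_concave_def
proof (intro ballI allI impI)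
  fix X Y Z
  assume X: "X \<in> feasible_upto \<F> (int k - 1)" and Y: "Y \<in> feasible_upto \<F> (int k - 1)"
    and Z: "maximal_feasible_subset \<F> (X \<inter> Y) Z"
  have finG: "finite (Gam E \<F> V)" for V using fE unfolding Gam_def by simp
  have ZF: "Z \<in> \<F>" "Z \<subseteq> X" "Z \<subseteq> Y" using Z unfolding maximal_feasible_subset_def by auto
  have XF: "X \<in> \<F>" "card X < k" "X \<subseteq> E" and YF: "Y \<in> \<F>" "card Y < k" "Y \<subseteq> E"
    using X Y sys unfolding feasible_upto_def set_system_def by auto
  \<comment> \<open>\<open>Z\<close> inherits the level bound, so \<open>Gam E \<F> Z\<close> is
    non-empty and its \<open>Min\<close> is attained.\<close>
  have "card Z \<le> card X" using ZF XF fE by (meson card_mono finite_subset)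
  then have "Z \<in> feasible_upto \<F> (int k - 1)"
    using ZF XF unfolding feasible_upto_def by simp
  then have "Gam E \<F> Z \<noteq> {}" using Gam by blast
  then have "linkage_min E \<F> \<pi> Z \<in> (\<lambda>x. \<pi> x Z) ` Gam E \<F> Z"
    unfolding linkage_min_def using finG by (intro Min_in) auto
  then obtain x where x: "x \<in> Gam E \<F> Z" "linkage_min E \<F> \<pi> Z = \<pi> x Z" by blast
  have le: "linkage_min E \<F> \<pi> V \<le> linkage_min E \<F> \<pi> Z"
    if V: "V \<in> \<F>" "card V < k" "V \<subseteq> E" "Z \<subseteq> V" "x \<notin> V" for V
  proof -
    have "x \<in> Gam E \<F> V" using truncated_antimatroid_augment[OF tr ZF(1) V(1,4,2) x(1) V(5)] .
    then have "linkage_min E \<F> \<pi> V \<le> \<pi> x V"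
      unfolding linkage_min_def using finG by (intro Min_le) auto
    also have "\<dots> \<le> \<pi> x Z" using mono V x unfolding monotone_linkage_def Gam_def by auto
    finally show ?thesis using x by simp
  qed
  \<comment> \<open>Otherwise \<open>Z \<union> {x}\<close> would contradict the maximality of
    \<open>Z\<close>.\<close>
  have "x \<notin> X \<inter> Y"
  proof
    assume "x \<in> X \<inter> Y"
    then have "Z \<union> {x} \<in> \<F>" "Z \<union> {x} \<subseteq> X \<inter> Y" "Z \<subseteq> Z \<union> {x}"
      using x ZF unfolding Gam_def by auto
    then have "Z \<union> {x} = Z"
      using Z unfolding maximal_feasible_subset_def by blast
    then show False using x unfolding Gam_def by auto
  qed
  then show "min (linkage_min E \<F> \<pi> X) (linkage_min E \<F> \<pi> Y) \<le> linkage_min E \<F> \<pi> Z"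
    using le[of X] le[of Y] XF YF ZF by (auto simp: min_le_iff_disj)
qed

section \<open>From quasi-concavity to the extension property\<close>

lemma quasi_concave_imp_extendable:
  assumes fE: "finite E" and sys: "set_system E \<F>"
    and Gam: "\<forall>X\<in>feasible_upto \<F> (int k - 1). Gam E \<F> X \<noteq> {}"
    and qc: "\<And>\<pi>. monotone_linkage E \<pi> \<Longrightarrow> quasi_concave \<F> k (linkage_min E \<F> \<pi>)"
  shows "extendable \<F> k"
  unfolding extendable_def
proof (intro ballI allI impI, elim conjE, rule ccontr)
  fix A B x
  assume AB: "A \<in> \<F>" "B \<in> \<F>" "A \<subseteq> B" "card B < k" "x \<notin> B" "insert x A \<in> \<F>"
    and not: "insert x B \<notin> \<F>"
  \<comment> \<open>Being constant in the set argument, this linkage is trivially monotone; its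
    minimum detects whether \<open>x\<close> can be added.\<close>
  define \<pi> :: "'a \<Rightarrow> 'a set \<Rightarrow> real" where "\<pi> = (\<lambda>y _. if y = x then 0 else 1)"
  have finG: "finite (Gam E \<F> V)" for V using fE unfolding Gam_def by simp
  have finB: "finite B" using AB sys fE finite_subset unfolding set_system_def by blast
  \<comment> \<open>Properness of \<open>A \<subseteq> B\<close> leaves room for \<open>x\<close>,
    so that \<open>insert x A\<close> also has fewer than \<open>k\<close> elements.\<close>
  have "A \<noteq> B" using AB not by blast
  then have "card A < card B" using AB finB by (intro psubset_card_mono) auto
  then have "card (insert x A) \<le> card B"
    using card_insert_le_m1[of "card B" A x] by simp
  then have B: "B \<in> feasible_upto \<F> (int k - 1)"
    and A: "insert x A \<in> feasible_upto \<F> (int k - 1)"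
    using AB unfolding feasible_upto_def by auto
  \<comment> \<open>Non-emptiness of \<open>Gam E \<F> V\<close> matters here: it makes the image
    exactly \<open>{1}\<close>.\<close>
  have one: "linkage_min E \<F> \<pi> V = 1"
    if V: "V \<in> feasible_upto \<F> (int k - 1)" "x \<notin> Gam E \<F> V" for V
  proof -
    have "(\<lambda>y. \<pi> y V) ` Gam E \<F> V = {1}"
      using Gam V unfolding \<pi>_def by (auto simp: image_iff)
    then show ?thesis unfolding linkage_min_def by simp
  qed
  have "x \<in> Gam E \<F> A" using AB sys unfolding Gam_def set_system_def by auto
  then have "linkage_min E \<F> \<pi> A \<le> \<pi> x A"
    unfolding linkage_min_def using finG by (intro Min_le) auto
  \<comment> \<open>The intersection is \<open>A\<close> itself, because
    \<open>x \<notin> B\<close>; being feasible, it is its own maximal feasible subset.\<close>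
  moreover have "maximal_feasible_subset \<F> (B \<inter> insert x A) A"
    using AB unfolding maximal_feasible_subset_def by blast
  moreover have "monotone_linkage E \<pi>" unfolding monotone_linkage_def \<pi>_def by simp
  ultimately have "min (linkage_min E \<F> \<pi> B) (linkage_min E \<F> \<pi> (insert x A)) \<le> 0"
    using qc[of \<pi>] A B unfolding quasi_concave_def \<pi>_def by fastforce
  moreover have "linkage_min E \<F> \<pi> B = 1" using one[OF B] not unfolding Gam_def by simp
  \<comment> \<open>\<open>Gam\<close> excludes the elements of the set, so \<open>x\<close> cannot
    contribute the value 0.\<close>
  moreover have "linkage_min E \<F> \<pi> (insert x A) = 1" using one[OF A] unfolding Gam_def by simp
  ultimately show False by simp
qed

theorem theorem5:
  fixes E :: "'a set" and \<F> :: "'a set set" and k :: nat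
  assumes "finite E"
    and "set_system E \<F>"
    and "accessible \<F>"
    and "has_rank \<F> k"
    and "\<forall>X\<in>feasible_upto \<F> (int k - 1). Gam E \<F> X \<noteq> {}"
  shows "truncated_antimatroid k E \<F> \<longleftrightarrow>
    (\<forall>\<pi> :: 'a \<Rightarrow> 'a set \<Rightarrow> real. monotone_linkage E \<pi> \<longrightarrow>
       quasi_concave \<F> k (linkage_min E \<F> \<pi>))"
proof
  assume "truncated_antimatroid k E \<F>"
  then show "\<forall>\<pi> :: 'a \<Rightarrow> 'a set \<Rightarrow> real. monotone_linkage E \<pi> \<longrightarrow>
       quasi_concave \<F> k (linkage_min E \<F> \<pi>)"
    using truncated_antimatroid_imp_quasi_concave[OF assms(1,2,5)] by blast
next
  assume "\<forall>\<pi> :: 'a \<Rightarrow> 'a set \<Rightarrow> real. monotone_linkage E \<pi> \<longrightarrow>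
       quasi_concave \<F> k (linkage_min E \<F> \<pi>)"
  then have "extendable \<F> k"
    using quasi_concave_imp_extendable[OF assms(1,2,5)] by blast
  \<comment> \<open>Finiteness makes the \<open>Max\<close> in \<open>has_rank\<close> an upper
    bound for all cardinalities.\<close>
  moreover have "finite \<F>"
    using assms(1,2) unfolding set_system_def by (meson finite_Pow_iff finite_subset)
  then have "card X \<le> k" if "X \<in> \<F>" for X
    using assms(4) that unfolding has_rank_def by simp
  moreover have "\<F> \<noteq> {}" using assms(4) unfolding has_rank_def by blast
  ultimately show "truncated_antimatroid k E \<F>"
    using extendable_imp_truncated_antimatroid[OF assms(1-3)] by blast
qed

end
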